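(* Let $\mathcal{F}$ be a family of $n$ pseudo-discs in the plane all containing a common point $O$ in their interior. Then for every $k$ we have $g(\mathcal{F},k)\le 2(k-1)n$.
   Context: A family $\mathcal{F}$ of sets in the plane is nice if every member is a region bounded by a simple closed Jordan curve and these boundary curves are in general position: any two cross in only finitely many points, no two curves touch or overlap, and no three curves pass through a common point. A nice family is a family of pseudo-discs if the boundaries of every two of its members intersect in at most two points. For a family $\mathcal{F}$ of pseudo-discs and an integer $k$, $g(\mathcal{F},k)$ denotes the number of intersection points of two boundaries of sets in $\mathcal{F}$ that are contained in at most $k$ sets from $\mathcal{F}$.
   Formalization: The bound 2(k-1)n is proved for every integer k ≥ 1; for k = 0, where the stated bound would be negative and fails already for a single disc, the claim is g(F,0) = 0, and negative k are not considered. Regions are taken to be closed. *)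

theory Defs
  imports "HOL-Analysis.Analysis"
begin

definition jordan_region :: "complex set \<Rightarrow> bool" where
  "jordan_region D \<longleftrightarrow>
     (\<exists>\<gamma>. simple_path \<gamma> \<and> pathfinish \<gamma> = pathstart \<gamma> \<and>
          D = path_image \<gamma> \<union> inside (path_image \<gamma>))"

definition crosses_at :: "complex set \<Rightarrow> complex set \<Rightarrow> complex \<Rightarrow> bool" where
  "crosses_at A B p \<longleftrightarrow>
     (\<forall>e>0. ball p e \<inter> (interior A \<inter> interior B) \<noteq> {} \<and>
            ball p e \<inter> (interior A - B) \<noteq> {} \<and>
            ball p e \<inter> (interior B - A) \<noteq> {} \<and>
            ball p e - (A \<union> B) \<noteq> {})"

definition nice_family :: "complex set set \<Rightarrow> bool" where
  "nice_family F \<longleftrightarrow>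
     (\<forall>D\<in>F. jordan_region D) \<and>
     (\<forall>A\<in>F. \<forall>B\<in>F. A \<noteq> B \<longrightarrow>
        finite (frontier A \<inter> frontier B) \<and>
        (\<forall>p \<in> frontier A \<inter> frontier B. crosses_at A B p)) \<and>
     (\<forall>A\<in>F. \<forall>B\<in>F. \<forall>C\<in>F. A \<noteq> B \<and> A \<noteq> C \<and> B \<noteq> C \<longrightarrow>
        frontier A \<inter> frontier B \<inter> frontier C = {})"

definition pseudo_disc_family :: "complex set set \<Rightarrow> bool" where
  "pseudo_disc_family F \<longleftrightarrow> nice_family F \<and>
     (\<forall>A\<in>F. \<forall>B\<in>F. A \<noteq> B \<longrightarrow> card (frontier A \<inter> frontier B) \<le> 2)"

definition g_count :: "complex set set \<Rightarrow> nat \<Rightarrow> nat" where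
  "g_count F k = card {p. (\<exists>A\<in>F. \<exists>B\<in>F. A \<noteq> B \<and> p \<in> frontier A \<inter> frontier B) \<and>
                          card {C\<in>F. p \<in> C} \<le> k}"

end

theory Submission
  imports Defs
begin

text \<open>
  Shoot a ray from the common point \<open>O\<close> and let \<open>c A\<close> be the first point where it meets the
  boundary of \<open>A\<close>. The segment from \<open>O\<close> to \<open>c A\<close> lies in \<open>A\<close>, so for any two members
  \<open>A\<close>, \<open>B\<close> we have \<open>c A \<in> B\<close> or \<open>c B \<in> A\<close>. If \<open>c A \<in> B\<close>, charge the (at most two) crossings of
  the boundaries to \<open>A\<close>: traversing the boundary of \<open>A\<close> from \<open>c A\<close> in either direction, one stays
  in \<open>B\<close> until reaching one of them. In a fixed direction, the first charged crossing of depth at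
  most \<open>k\<close> then lies in \<open>A\<close> and in every other \<open>B\<close> which contributes such a crossing. Hence there are
  at most \<open>k - 1\<close> of them per direction.
\<close>

section \<open>Jordan regions and parametrizations of their boundaries\<close>

text \<open>By the Jordan curve theorem the complement of \<open>D\<close> is the outer component,
  which is open with the curve as its frontier. Removing its closure leaves the inner component, so
  that component is \<open>interior D\<close>.\<close>

lemma jordan_region_topology:
  assumes "jordan_region D"
  obtains \<gamma> where "simple_path \<gamma>" "pathfinish \<gamma> = pathstart \<gamma>" "path_image \<gamma> = frontier D"
    "compact D" "connected (interior D)"
proof -
  obtain \<gamma> where \<gamma>: "simple_path \<gamma>" "pathfinish \<gamma> = pathstart \<gamma>"
    and D: "D = path_image \<gamma> \<union> inside (path_image \<gamma>)"
    using assms unfolding jordan_region_def by blast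
  note J = Jordan_inside_outside[OF \<gamma>]
  have outside: "- D = outside (path_image \<gamma>)"
    using D union_with_inside by blast
  have "closed D"
    using J outside by (simp add: closed_def)
  have "bounded D"
    using D J \<gamma>(1) by (simp add: bounded_simple_path_image)
  have "closure (- D) = path_image \<gamma> \<union> outside (path_image \<gamma>)"
    using J outside by (metis closure_Un_frontier sup_commute)
  then have int: "interior D = inside (path_image \<gamma>)"
    by (simp add: interior_closure union_with_outside)
  have "frontier D = path_image \<gamma>"
    using J outside by (metis frontier_complement)
  then show ?thesis
    using that \<gamma> \<open>closed D\<close> \<open>bounded D\<close> J int by (simp add: compact_eq_bounded_closed)
qed

text \<open>Moves the base point of the loop, so that a traversal can begin at the point where the
  ray hits the boundary.\<close>

lemma jordan_region_path_from:
  assumes "jordan_region D" "c \<in> frontier D"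
  obtains \<gamma> where "simple_path \<gamma>" "pathstart \<gamma> = c" "pathfinish \<gamma> = c"
    "path_image \<gamma> = frontier D"
proof -
  obtain \<gamma> where \<gamma>: "simple_path \<gamma>" "pathfinish \<gamma> = pathstart \<gamma>" "path_image \<gamma> = frontier D"
    using jordan_region_topology[OF assms(1)] by metis
  have "c \<in> path_image \<gamma>"
    using assms(2) \<gamma>(3) by simp
  then obtain a where a: "a \<in> {0..1}" "\<gamma> a = c"
    by (auto simp: path_image_def)
  show ?thesis
  proof
    show "simple_path (shiftpath a \<gamma>)"
      using \<gamma> a by (simp add: simple_path_shiftpath)
    show "pathstart (shiftpath a \<gamma>) = c"
      using a by (simp add: pathstart_shiftpath)
    show "pathfinish (shiftpath a \<gamma>) = c"
      using \<gamma> a by (simp add: pathfinish_shiftpath)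
    show "path_image (shiftpath a \<gamma>) = frontier D"
      using \<gamma> a by (simp add: path_image_shiftpath)
  qed
qed

lemma connected_meets_imp_subset:
  assumes "connected T" "T \<inter> frontier B = {}" "T \<inter> B \<noteq> {}"
  shows "T \<subseteq> B"
  using connected_Int_frontier[OF assms(1,3)] assms(2) by blast

section \<open>Boundary arcs of one region inside another\<close>

text \<open>Near a crossing the connected set \<open>interior B\<close> has points in
  \<open>A\<close> and points off \<open>A\<close>, so it cannot miss the frontier of
  \<open>A\<close>. This later identifies an arc inside \<open>B\<close> when the base point is
  itself a crossing.\<close>

lemma crossing_boundary_meets_interior:
  assumes "jordan_region B" "crosses_at A B p"
  shows "frontier A \<inter> interior B \<noteq> {}"
proof -
  have "connected (interior B)"
    using jordan_region_topology[OF assms(1)] by metis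
  moreover have "ball p 1 \<inter> (interior A \<inter> interior B) \<noteq> {}" "ball p 1 \<inter> (interior B - A) \<noteq> {}"
    using assms(2) unfolding crosses_at_def by simp_all
  then have "interior B \<inter> A \<noteq> {}" "interior B - A \<noteq> {}"
    using interior_subset by blast+
  ultimately show ?thesis
    using connected_Int_frontier by blast
qed

text \<open>The crossings cut the boundary of \<open>A\<close> into arcs that avoid the frontier of
  \<open>B\<close>, and by connectedness each arc lies wholly inside or wholly outside
  \<open>B\<close>. The parameters \<open>s\<close> and \<open>t\<close> end the stretches in
  \<open>B\<close> going forward from 0 and backward from 1; a stretch may degenerate to the base
  point.\<close>

lemma boundary_arcs_inside:
  assumes B: "jordan_region B"
    and \<gamma>: "simple_path \<gamma>" "pathfinish \<gamma> = pathstart \<gamma>" "path_image \<gamma> = frontier A"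
    and start: "pathstart \<gamma> \<in> B"
    and V: "p \<in> frontier A \<inter> frontier B" "finite (frontier A \<inter> frontier B)"
      "card (frontier A \<inter> frontier B) \<le> 2"
    and cross: "crosses_at A B p"
  obtains s t where "s \<in> {0..1}" "t \<in> {0..1}" "\<gamma> ` {0..s} \<subseteq> B" "\<gamma> ` {t..1} \<subseteq> B"
    "frontier A \<inter> frontier B = {\<gamma> s, \<gamma> t}"
proof -
  let ?V = "frontier A \<inter> frontier B"
  have loop: "\<gamma> 1 = \<gamma> 0" and start': "\<gamma> 0 \<in> B"
    using \<gamma>(2) start by (auto simp: pathstart_def pathfinish_def)
  have inj: "x = y \<or> x = 0 \<and> y = 1 \<or> x = 1 \<and> y = 0"
    if "x \<in> {0..1}" "y \<in> {0..1}" "\<gamma> x = \<gamma> y" for x y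
    using \<gamma>(1) that unfolding simple_path_def loop_free_def by blast
  have cont: "continuous_on {0..1} \<gamma>"
    using \<gamma>(1) unfolding simple_path_def path_def by blast
  have "closed B"
    using jordan_region_topology[OF B] compact_imp_closed by metis
  then have VB: "?V \<subseteq> B"
    using frontier_subset_closed by blast
  \<comment> \<open>Requiring \<open>x < 1\<close> settles the ambiguity at the base point, which
    gets parameter 0.\<close>
  have param: "\<exists>x. 0 \<le> x \<and> x < 1 \<and> \<gamma> x = v" if "v \<in> ?V" for v
  proof -
    have "v \<in> path_image \<gamma>"
      using that \<gamma>(3) by simp
    then obtain x where x: "x \<in> {0..1}" "\<gamma> x = v"
      by (auto simp: path_image_def)
    show ?thesis
    proof (cases "x = 1")
      case True
      then show ?thesis using x loop by (intro exI[of _ 0]) auto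
    next
      case False
      then show ?thesis using x by (intro exI[of _ x]) auto
    qed
  qed
  \<comment> \<open>A single crossing is covered by \<open>q = p\<close>.\<close>
  have "\<exists>q. ?V = {p, q}"
  proof (cases "?V \<subseteq> {p}")
    case True
    then show ?thesis using V(1) by blast
  next
    case False
    then obtain q where q: "q \<in> ?V" "q \<noteq> p" by blast
    then have "{p, q} = ?V"
      using V by (intro card_seteq) auto
    then show ?thesis by blast
  qed
  then obtain q where q: "?V = {p, q}" ..
  obtain x y where xy: "0 \<le> x" "x < 1" "\<gamma> x = p" "0 \<le> y" "y < 1" "\<gamma> y = q"
    using param q by (metis insertI1 insert_commute)
  obtain a b where ab: "0 \<le> a" "a \<le> b" "b < 1" "?V = {\<gamma> a, \<gamma> b}"
  proof (cases "x \<le> y")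
    case True
    then show ?thesis using that[of x y] xy q by simp
  next
    case False
    then show ?thesis using that[of y x] xy q by (simp add: insert_commute)
  qed
  \<comment> \<open>Parameter 1 needs the proviso because it gives the same point as 0, which is a
    crossing when \<open>a = 0\<close>.\<close>
  have disj: "\<gamma> x \<notin> frontier B" if x: "x \<in> {0..1}" "x \<noteq> a" "x \<noteq> b" and "x = 1 \<Longrightarrow> 0 < a" for x
  proof
    assume "\<gamma> x \<in> frontier B"
    moreover have "\<gamma> x \<in> path_image \<gamma>"
      using x(1) by (simp add: path_image_def)
    ultimately have "\<gamma> x \<in> ?V"
      using \<gamma>(3) by simp
    then have "\<gamma> x = \<gamma> a \<or> \<gamma> x = \<gamma> b"
      using ab(4) by blast
    moreover have "a \<in> {0..1}" "b \<in> {0..1}" "a \<noteq> 1" "b \<noteq> 1" "b = 0 \<longrightarrow> a = 0"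
      using ab(1-3) by simp_all
    ultimately have "x = 1 \<and> a = 0"
      using inj[of x a] inj[of x b] x by metis
    then show False
      using that(4) by simp
  qed
  have arc: "\<gamma> ` I \<subseteq> B"
    if "connected I" "I \<subseteq> {0..1}" "a \<notin> I" "b \<notin> I" "1 \<in> I \<Longrightarrow> 0 < a" "\<gamma> ` I \<inter> B \<noteq> {}" for I
  proof (rule connected_meets_imp_subset)
    show "connected (\<gamma> ` I)"
      using that continuous_on_subset[OF cont] by (intro connected_continuous_image) auto
    show "\<gamma> ` I \<inter> frontier B = {}"
      using disj that by blast
  qed (use that in auto)
  have ends: "\<gamma> a \<in> B" "\<gamma> b \<in> B"
    using ab(4) VB by auto
  \<comment> \<open>If \<open>0 < a\<close>, the base point is in \<open>B\<close> off its frontier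
    and decides both adjacent arcs. If \<open>a = 0\<close>, it lies on the frontier and decides
    nothing; a point of \<open>frontier A\<close> in \<open>interior B\<close> then shows which open
    arc is in \<open>B\<close>.\<close>
  consider "0 < a" | "a = 0" "\<gamma> ` {b<..<1} \<inter> B \<noteq> {}" | "a = 0" "\<gamma> ` {0<..<b} \<inter> B \<noteq> {}"
  proof (cases "a = 0")
    case True
    obtain z where z: "z \<in> frontier A" "z \<in> interior B"
      using crossing_boundary_meets_interior[OF B cross] by blast
    then have "z \<notin> ?V"
      by (simp add: frontier_def)
    then have "z \<noteq> \<gamma> a" "z \<noteq> \<gamma> b"
      using ab(4) by blast+
    have "z \<in> path_image \<gamma>"
      using z(1) \<gamma>(3) by simp
    then obtain u where u: "u \<in> {0..1}" "z = \<gamma> u"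
      by (auto simp: path_image_def)
    then have "u \<in> {b<..<1} \<or> u \<in> {0<..<b}"
      using \<open>z \<noteq> \<gamma> a\<close> \<open>z \<noteq> \<gamma> b\<close> True loop by (cases "u = 0 \<or> u = 1 \<or> u = b") auto
    moreover have "z \<in> B"
      using z(2) interior_subset by blast
    ultimately show ?thesis
      using that True u(2) by blast
  qed (use ab that in auto)
  then show ?thesis
  proof cases
    case 1
    have "0 \<in> {0..<a}" "1 \<in> {b<..1}"
      using 1 ab by simp_all
    then have "\<gamma> ` {0..<a} \<inter> B \<noteq> {}" "\<gamma> ` {b<..1} \<inter> B \<noteq> {}"
      using start' loop by (metis IntI empty_iff imageI)+
    moreover have "{0..<a} \<subseteq> {0..1}" "{b<..1} \<subseteq> {0..1}"
      using ab(1-3) by auto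
    ultimately have "\<gamma> ` {0..<a} \<subseteq> B" "\<gamma> ` {b<..1} \<subseteq> B"
      using 1 ab(1-3) arc[of "{0..<a}"] arc[of "{b<..1}"] by simp_all
    moreover have "{0..a} = insert a {0..<a}" "{b..1} = insert b {b<..1}"
      using ab by auto
    ultimately show ?thesis
      using that[of a b] ab ends by simp
  next
    case 2
    have "{b<..<1} \<subseteq> {0..1}"
      using ab(1-3) by auto
    then have "\<gamma> ` {b<..<1} \<subseteq> B"
      using 2 ab(1-3) arc[of "{b<..<1}"] by simp
    moreover have "{b..1} = insert b (insert 1 {b<..<1})"
      using ab by auto
    ultimately show ?thesis
      using that[of a b] 2(1) ab ends loop by simp
  next
    case 3
    have "{0<..<b} \<subseteq> {0..1}"
      using ab(1-3) by auto
    then have "\<gamma> ` {0<..<b} \<subseteq> B"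
      using 3 ab(1-3) arc[of "{0<..<b}"] by simp
    moreover have "{0..b} = insert 0 (insert b {0<..<b})"
      using ab 3 by auto
    ultimately show ?thesis
      \<comment> \<open>The roles swap: the forward stretch ends at \<open>b\<close>, and the
        crossing at the base point is written with parameter 1, so the backward stretch is that
        point alone.\<close>
      using that[of b 1] 3(1) ab ends loop by (simp add: insert_commute)
  qed
qed

section \<open>First boundary point on a ray\<close>

text \<open>The hitting parameters form a nonempty closed set bounded below, so its infimum is
  attained. Before it the segment starts in \<open>D\<close> and avoids the frontier, hence stays in
  \<open>D\<close>.\<close>

lemma first_hit_on_ray:
  fixes D :: "'a::real_normed_vector set"
  assumes "closed D" "bounded D" "z \<in> interior D" "u \<noteq> 0"
  obtains r where "0 \<le> r" "z + r *\<^sub>R u \<in> frontier D" "\<And>x. 0 \<le> x \<Longrightarrow> x \<le> r \<Longrightarrow> z + x *\<^sub>R u \<in> D"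
proof -
  define h where "h x = z + x *\<^sub>R u" for x
  have cont: "continuous_on X h" for X
    unfolding h_def by (intro continuous_intros)
  define H where "H = {0..} \<inter> h -` frontier D"
  have "closed H"
    unfolding H_def by (intro continuous_closed_preimage cont) auto
  have "z \<in> D"
    using assms(3) interior_subset by blast
  have "H \<noteq> {}"
  proof -
    obtain R where R: "\<And>y. y \<in> D \<Longrightarrow> norm y \<le> R"
      using assms(2) bounded_iff by metis
    \<comment> \<open>Chosen so that \<open>h x\<close> has norm at least \<open>R + 1\<close>,
      beyond the bound on \<open>D\<close>.\<close>
    define x where "x = (R + norm z + 1) / norm u"
    have "0 \<le> R"
      using R[OF \<open>z \<in> D\<close>] norm_ge_zero order_trans by blast
    then have "0 \<le> x" "x * norm u = R + norm z + 1"
      using assms(4) by (auto simp: x_def)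
    then have "norm (x *\<^sub>R u) = R + norm z + 1"
      by simp
    moreover have "norm (x *\<^sub>R u) \<le> norm (h x) + norm z"
      unfolding h_def using norm_triangle_ineq4[of "z + x *\<^sub>R u" z] by simp
    ultimately have "h x \<notin> D"
      using R[of "h x"] by linarith
    moreover have "connected (h ` {0..x})"
      by (intro connected_continuous_image cont) auto
    moreover have "h 0 = z"
      by (simp add: h_def)
    ultimately have "h ` {0..x} \<inter> frontier D \<noteq> {}"
      using \<open>z \<in> D\<close> \<open>0 \<le> x\<close>
      by (intro connected_Int_frontier) (force simp: image_iff)+
    then show ?thesis
      unfolding H_def by auto
  qed
  have bdd: "bdd_below H"
    unfolding H_def by (auto intro: bdd_belowI)
  have r: "Inf H \<in> H"
    using closed_contains_Inf[OF \<open>H \<noteq> {}\<close> bdd \<open>closed H\<close>] .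
  have "h x \<in> D" if "0 \<le> x" "x \<le> Inf H" for x
  proof (cases "x = Inf H")
    case True
    then show ?thesis
      using r assms(1) frontier_subset_closed unfolding H_def by blast
  next
    case False
    have "h ` {0..x} \<subseteq> D"
    proof (rule connected_meets_imp_subset)
      show "connected (h ` {0..x})"
        by (intro connected_continuous_image cont) auto
      have "y \<notin> H" if "y \<le> x" for y
        using cInf_lower[OF _ bdd, of y] that False \<open>x \<le> Inf H\<close> by fastforce
      then show "h ` {0..x} \<inter> frontier D = {}"
        unfolding H_def by auto
      show "h ` {0..x} \<inter> D \<noteq> {}"
        using \<open>z \<in> D\<close> \<open>0 \<le> x\<close> by (force simp: h_def)
    qed
    then show ?thesis
      using that by auto
  qed
  then show ?thesis
    using that[of "Inf H"] r unfolding H_def h_def by auto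
qed

section \<open>Depth of nested points\<close>

text \<open>Among the members with a shallow point, one with minimal \<open>e\<close> has its point
  in all of them and in \<open>A\<close>. The depth bound \<open>k\<close> thus limits their
  number.\<close>

lemma card_shallow_nested_points:
  fixes F :: "'a set set" and e :: "'a set \<Rightarrow> 'b::linorder" and v :: "'a set \<Rightarrow> 'a"
  assumes "finite F" "G \<subseteq> F" "A \<in> F" "A \<notin> G"
    and base: "\<And>B. B \<in> G \<Longrightarrow> v B \<in> A"
    and nested: "\<And>B C. B \<in> G \<Longrightarrow> C \<in> G \<Longrightarrow> e B \<le> e C \<Longrightarrow> v B \<in> C"
  shows "card {B \<in> G. card {C \<in> F. v B \<in> C} \<le> k} \<le> k - 1"
proof (cases "{B \<in> G. card {C \<in> F. v B \<in> C} \<le> k} = {}")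
  case False
  define S where "S = {B \<in> G. card {C \<in> F. v B \<in> C} \<le> k}"
  have "finite S" "S \<noteq> {}" "S \<subseteq> G"
    using finite_subset[OF assms(2,1)] False by (auto simp: S_def)
  define B where "B = arg_min_on e S"
  have B: "B \<in> S" "\<And>C. C \<in> S \<Longrightarrow> e B \<le> e C"
    using \<open>finite S\<close> \<open>S \<noteq> {}\<close> by (auto simp: B_def arg_min_if_finite(1) arg_min_least)
  \<comment> \<open>The additional set \<open>A\<close>, which is not in \<open>S\<close>, improves
    the bound from \<open>k\<close> to \<open>k - 1\<close>.\<close>
  have "insert A S \<subseteq> {C \<in> F. v B \<in> C}"
    using B base nested \<open>S \<subseteq> G\<close> assms(2,3) by blast
  then have "card (insert A S) \<le> card {C \<in> F. v B \<in> C}"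
    using assms(1) by (intro card_mono) auto
  also have "\<dots> \<le> k"
    using B(1) by (simp add: S_def)
  finally have "Suc (card S) \<le> k"
    using \<open>finite S\<close> \<open>S \<subseteq> G\<close> assms(4) by (metis card_insert_disjoint subsetD)
  then show ?thesis
    unfolding S_def by linarith
next
  case True
  then show ?thesis by (metis card.empty zero_le)
qed

section \<open>Charging shallow crossings to boundary curves\<close>

theorem theorem3:
  fixes F :: "complex set set" and o0 :: complex and n k :: nat
  assumes "finite F" and "card F = n"
    and "pseudo_disc_family F"
    and "\<forall>D\<in>F. o0 \<in> interior D"
  shows "g_count F k \<le> 2 * (k - 1) * n"
proof -
  have nice: "nice_family F"
    and two: "\<And>A B. A \<in> F \<Longrightarrow> B \<in> F \<Longrightarrow> A \<noteq> B \<Longrightarrow> card (frontier A \<inter> frontier B) \<le> 2"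
    using assms(3) unfolding pseudo_disc_family_def by blast+
  have region: "\<And>A. A \<in> F \<Longrightarrow> jordan_region A"
    and fin: "\<And>A B. A \<in> F \<Longrightarrow> B \<in> F \<Longrightarrow> A \<noteq> B \<Longrightarrow> finite (frontier A \<inter> frontier B)"
    and cross: "\<And>A B p. A \<in> F \<Longrightarrow> B \<in> F \<Longrightarrow> A \<noteq> B \<Longrightarrow> p \<in> frontier A \<inter> frontier B \<Longrightarrow> crosses_at A B p"
    using nice unfolding nice_family_def by simp_all
  have compact: "compact A" if "A \<in> F" for A
    using jordan_region_topology[OF region[OF that]] by metis
  \<comment> \<open>All members use the same ray, in direction 1, so their hit points are ordered by
    distance from \<open>o0\<close>.\<close>
  have "\<forall>A\<in>F. \<exists>r\<ge>0. o0 + of_real r \<in> frontier A \<and> (\<forall>x. 0 \<le> x \<longrightarrow> x \<le> r \<longrightarrow> o0 + of_real x \<in> A)"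
  proof
    fix A assume "A \<in> F"
    then obtain r where "0 \<le> r" "o0 + r *\<^sub>R 1 \<in> frontier A"
      "\<And>x. 0 \<le> x \<Longrightarrow> x \<le> r \<Longrightarrow> o0 + x *\<^sub>R 1 \<in> A"
      using first_hit_on_ray[of A o0 1] compact assms(4)
      by (auto simp: compact_eq_bounded_closed)
    then show "\<exists>r\<ge>0. o0 + of_real r \<in> frontier A \<and>
        (\<forall>x. 0 \<le> x \<longrightarrow> x \<le> r \<longrightarrow> o0 + of_real x \<in> A)"
      by (auto simp: of_real_def)
  qed
  then obtain r where r: "\<And>A. A \<in> F \<Longrightarrow> 0 \<le> r A" "\<And>A. A \<in> F \<Longrightarrow> o0 + of_real (r A) \<in> frontier A"
    "\<And>A x. A \<in> F \<Longrightarrow> 0 \<le> x \<Longrightarrow> x \<le> r A \<Longrightarrow> o0 + of_real x \<in> A"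
    unfolding Bex_def by metis
  define c where "c A = o0 + complex_of_real (r A)" for A
  \<comment> \<open>The nearer hit point lies on the segment to the farther one, and that segment is
    contained in the other member.\<close>
  have total: "c A \<in> B \<or> c B \<in> A" if "A \<in> F" "B \<in> F" for A B
    using r(1,3) that unfolding c_def by (metis linear)
  have "\<forall>A\<in>F. \<exists>\<gamma>. simple_path \<gamma> \<and> pathstart \<gamma> = c A \<and> pathfinish \<gamma> = c A \<and> path_image \<gamma> = frontier A"
    using jordan_region_path_from region r(2) unfolding c_def by metis
  then obtain \<gamma> where \<gamma>: "\<And>A. A \<in> F \<Longrightarrow> simple_path (\<gamma> A) \<and> pathstart (\<gamma> A) = c A \<and>
      pathfinish (\<gamma> A) = c A \<and> path_image (\<gamma> A) = frontier A"
    by metis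
  \<comment> \<open>These are the members whose crossings with \<open>A\<close> may be charged to
    \<open>A\<close>.\<close>
  define E where "E A = {B \<in> F. B \<noteq> A \<and> c A \<in> B \<and> frontier A \<inter> frontier B \<noteq> {}}" for A
  have "\<exists>s t. s \<in> {0..1} \<and> t \<in> {0..1} \<and> \<gamma> A ` {0..s} \<subseteq> B \<and> \<gamma> A ` {t..1} \<subseteq> B \<and>
      frontier A \<inter> frontier B = {\<gamma> A s, \<gamma> A t}" if "A \<in> F" "B \<in> E A" for A B
  proof -
    obtain p where p: "p \<in> frontier A \<inter> frontier B"
      using \<open>B \<in> E A\<close> unfolding E_def by blast
    have B: "B \<in> F" "A \<noteq> B" "c A \<in> B"
      using \<open>B \<in> E A\<close> unfolding E_def by auto
    show ?thesis
      using boundary_arcs_inside[of B "\<gamma> A" A p] \<gamma>[OF \<open>A \<in> F\<close>] p B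
        region[OF B(1)] fin[OF \<open>A \<in> F\<close> B(1,2)] two[OF \<open>A \<in> F\<close> B(1,2)] cross[OF \<open>A \<in> F\<close> B(1,2) p]
      by metis
  qed
  then obtain s t where st: "\<And>A B. A \<in> F \<Longrightarrow> B \<in> E A \<Longrightarrow>
      s A B \<in> {0..1} \<and> t A B \<in> {0..1} \<and> \<gamma> A ` {0..s A B} \<subseteq> B \<and> \<gamma> A ` {t A B..1} \<subseteq> B \<and>
      frontier A \<inter> frontier B = {\<gamma> A (s A B), \<gamma> A (t A B)}"
    by metis
  define d where "d p = card {C \<in> F. p \<in> C}" for p
  \<comment> \<open>\<open>S A\<close> collects the shallow charged crossings found in the forward
    direction, \<open>T A\<close> those in the backward direction.\<close>
  define S where "S A = (\<lambda>B. \<gamma> A (s A B)) ` {B \<in> E A. d (\<gamma> A (s A B)) \<le> k}" for A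
  define T where "T A = (\<lambda>B. \<gamma> A (t A B)) ` {B \<in> E A. d (\<gamma> A (t A B)) \<le> k}" for A
  have finE: "finite (E A)" for A
    using assms(1) unfolding E_def by simp
  have on_A: "\<gamma> A (s A B) \<in> A \<and> \<gamma> A (t A B) \<in> A" if "A \<in> F" "B \<in> E A" for A B
  proof -
    have "frontier A \<subseteq> A"
      using compact[OF that(1)] by (simp add: compact_imp_closed frontier_subset_closed)
    then show ?thesis
      using st[OF that] by blast
  qed
  have card_S: "card (S A) \<le> k - 1" if "A \<in> F" for A
  proof -
    have "card (S A) \<le> card {B \<in> E A. d (\<gamma> A (s A B)) \<le> k}"
      unfolding S_def using finE by (intro card_image_le) simp
    also have "\<dots> \<le> k - 1"
      unfolding d_def
    proof (rule card_shallow_nested_points[where e = "s A", OF assms(1) _ that])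
      \<comment> \<open>A larger \<open>s\<close> means a longer initial stretch, which contains the
        earlier crossing.\<close>
      show "\<gamma> A (s A B) \<in> C" if "B \<in> E A" "C \<in> E A" "s A B \<le> s A C" for B C
        using st[OF \<open>A \<in> F\<close> that(1)] st[OF \<open>A \<in> F\<close> that(2)] that(3) by auto
    qed (use on_A that in \<open>auto simp: E_def\<close>)
    finally show ?thesis .
  qed
  have card_T: "card (T A) \<le> k - 1" if "A \<in> F" for A
  proof -
    have "card (T A) \<le> card {B \<in> E A. d (\<gamma> A (t A B)) \<le> k}"
      unfolding T_def using finE by (intro card_image_le) simp
    also have "\<dots> \<le> k - 1"
      unfolding d_def
    \<comment> \<open>The sign reverses the order: final stretches grow as \<open>t\<close>
      decreases.\<close>
    proof (rule card_shallow_nested_points[where e = "\<lambda>B. - t A B", OF assms(1) _ that])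
      show "\<gamma> A (t A B) \<in> C" if "B \<in> E A" "C \<in> E A" "- t A B \<le> - t A C" for B C
        using st[OF \<open>A \<in> F\<close> that(1)] st[OF \<open>A \<in> F\<close> that(2)] that(3) by auto
    qed (use on_A that in \<open>auto simp: E_def\<close>)
    finally show ?thesis .
  qed
  have charge: "p \<in> S A \<union> T A"
    if "A \<in> F" "B \<in> F" "A \<noteq> B" "p \<in> frontier A \<inter> frontier B" "d p \<le> k" "c A \<in> B" for A B p
  proof -
    have "B \<in> E A"
      using that unfolding E_def by blast
    then show ?thesis
      using st[OF \<open>A \<in> F\<close> \<open>B \<in> E A\<close>] that(4,5) unfolding S_def T_def by auto
  qed
  \<comment> \<open>By \<open>total\<close> each crossing is charged to at least one of its two
    curves; being charged to both does no harm to an upper bound.\<close>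
  have "{p. (\<exists>A\<in>F. \<exists>B\<in>F. A \<noteq> B \<and> p \<in> frontier A \<inter> frontier B) \<and> d p \<le> k} \<subseteq> (\<Union>A\<in>F. S A \<union> T A)"
  proof
    fix p assume "p \<in> {p. (\<exists>A\<in>F. \<exists>B\<in>F. A \<noteq> B \<and> p \<in> frontier A \<inter> frontier B) \<and> d p \<le> k}"
    then obtain A B where AB: "A \<in> F" "B \<in> F" "A \<noteq> B" "p \<in> frontier A \<inter> frontier B" "d p \<le> k"
      by blast
    then show "p \<in> (\<Union>A\<in>F. S A \<union> T A)"
      using charge[of A B p] charge[of B A p] total[of A B] by blast
  qed
  moreover have "finite (\<Union>A\<in>F. S A \<union> T A)"
    using assms(1) finE unfolding S_def T_def by simp
  ultimately have "g_count F k \<le> card (\<Union>A\<in>F. S A \<union> T A)"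
    unfolding g_count_def d_def by (rule card_mono[rotated])
  also have "\<dots> \<le> (\<Sum>A\<in>F. card (S A \<union> T A))"
    using assms(1) by (rule card_UN_le)
  also have "\<dots> \<le> (\<Sum>A\<in>F. 2 * (k - 1))"
  proof (rule sum_mono)
    fix A assume "A \<in> F"
    then show "card (S A \<union> T A) \<le> 2 * (k - 1)"
      using card_Un_le[of "S A" "T A"] card_S[of A] card_T[of A] by linarith
  qed
  also have "\<dots> = 2 * (k - 1) * n"
    using assms(2) by simp
  finally show ?thesis .
qed

end
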